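(* For every sufficiently large natural number $n$, \[ n-1 \le k(n) \le \frac{n^2}{2}. \]
   Context: Let $P$ be a set of $2n$ points in the plane in general position (no three on a line). A perfect straight-line matching $M$ on $P$ is a set of $n$ segments with endpoints in $P$ such that each point of $P$ is an endpoint of exactly one segment; $M$ is non-crossing if no two of its segments cross. If two segments $\mathrm{seg}(a,b),\mathrm{seg}(c,d)$ of $M$ cross, a flip replaces them by two non-crossing segments on the same four points $\{a,b,c,d\}$ (either $\mathrm{seg}(a,c),\mathrm{seg}(b,d)$ or $\mathrm{seg}(a,d),\mathrm{seg}(b,c)$, whichever pair does not cross), yielding a new perfect matching called a successor of $M$. A valid sequence of length $k$ starting at $M$ is a sequence $(M_0,\dots,M_k)$ with $M_0=M$, each $M_{i+1}$ a successor of $M_i$, and $M_k$ non-crossing. Let $h(M)$ be the minimum length of a valid sequence starting at $M$, and let $k(n)$ be the maximum of $h(M)$ over all perfect straight-line matchings $M$ on all sets of $2n$ points in the plane in general position. *)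

theory Defs
  imports "HOL-Analysis.Analysis" "HOL-Library.Extended_Nat" "HOL-Library.Extended_Real"
begin

type_synonym point = "real ^ 2"

(* A segment with distinct endpoints a, b is represented by the set {a, b}. *)
type_synonym edge = "point set"

definition general_position :: "point set \<Rightarrow> bool" where
  "general_position P \<longleftrightarrow>
     (\<forall>a\<in>P. \<forall>b\<in>P. \<forall>c\<in>P. a \<noteq> b \<and> b \<noteq> c \<and> a \<noteq> c \<longrightarrow> \<not> collinear {a, b, c})"

definition perfect_matching :: "point set \<Rightarrow> edge set \<Rightarrow> bool" where
  "perfect_matching P M \<longleftrightarrow>
     (\<forall>e\<in>M. \<exists>a\<in>P. \<exists>b\<in>P. a \<noteq> b \<and> e = {a, b}) \<and>
     (\<forall>p\<in>P. \<exists>!e. e \<in> M \<and> p \<in> e)"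

(* Used only for segments with four distinct endpoints in general position; there
   the open segments meet iff the closed ones do, and then in a single point. *)
definition crosses :: "edge \<Rightarrow> edge \<Rightarrow> bool" where
  "crosses e f \<longleftrightarrow>
     (\<exists>a b c d. e = {a, b} \<and> f = {c, d} \<and> open_segment a b \<inter> open_segment c d \<noteq> {})"

definition noncrossing :: "edge set \<Rightarrow> bool" where
  "noncrossing M \<longleftrightarrow> (\<forall>e\<in>M. \<forall>f\<in>M. e \<noteq> f \<longrightarrow> \<not> crosses e f)"

(* In general position both replacement pairs N are non-crossing, so a crossing
   pair can be flipped in two ways. *)
definition successor :: "edge set \<Rightarrow> edge set \<Rightarrow> bool" where
  "successor M M' \<longleftrightarrow>
     (\<exists>a b c d N. {a, b} \<in> M \<and> {c, d} \<in> M \<and> {a, b} \<noteq> {c, d} \<and> crosses {a, b} {c, d} \<and>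
        (N = {{a, c}, {b, d}} \<or> N = {{a, d}, {b, c}}) \<and> noncrossing N \<and>
        M' = (M - {{a, b}, {c, d}}) \<union> N)"

(* Only the values s 0, ..., s k are relevant. *)
definition valid_sequence :: "edge set \<Rightarrow> nat \<Rightarrow> (nat \<Rightarrow> edge set) \<Rightarrow> bool" where
  "valid_sequence M k s \<longleftrightarrow>
     s 0 = M \<and> (\<forall>i<k. successor (s i) (s (Suc i))) \<and> noncrossing (s k)"

(* The value is infinity if there is no valid sequence; otherwise the infimum is
   a minimum. *)
definition min_flips :: "edge set \<Rightarrow> enat" where
  "min_flips M = Inf {enat k | k. \<exists>s. valid_sequence M k s}"

(* A finite supremum of a nonempty set in enat is a maximum. *)
definition max_min_flips :: "nat \<Rightarrow> enat" where
  "max_min_flips n =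
     Sup {min_flips M | M P. finite P \<and> card P = 2 * n \<and> general_position P \<and>
            perfect_matching P M}"

end

theory Submission
  imports Defs
begin

text \<open>Upper bound: order the points lexicographically and let the length of an edge be the
  difference of the ranks of its endpoints. The total length is at most \<open>n\<^sup>2\<close>, because the length of
  an edge is at most the sum of the distances of its endpoints' ranks to the middle rank. If two
  edges on \<open>p\<^sub>1 < p\<^sub>2 < p\<^sub>3 < p\<^sub>4\<close> cross, then flipping them to \<open>p\<^sub>1p\<^sub>2\<close>, \<open>p\<^sub>3p\<^sub>4\<close> is allowed and
  shortens the matching by at least 2.

  Lower bound: on the parabola points with abscissae \<open>-(n-1), \<dots>, n\<close>, take the \<open>n - 1\<close> horizontal
  chords together with the chord from \<open>0\<close> to \<open>n\<close>. Horizontal chords do not cross each other, so a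
  flip destroys at most one of them. A surviving one cuts off an odd number of points, so it is
  crossed by another edge; hence all of them have to be destroyed.\<close>

section \<open>Matchings and flips\<close>

text \<open>Crossing is defined through some naming of the endpoints; an open segment is symmetric
  in its endpoints, so every naming gives the same answer.\<close>

lemma crosses_pair_iff:
  "crosses {a, b} {c, d} \<longleftrightarrow> open_segment a b \<inter> open_segment c d \<noteq> {}"
proof
  assume "crosses {a, b} {c, d}"
  then obtain a' b' c' d' where "{a, b} = {a', b'}" "{c, d} = {c', d'}"
    and ne: "open_segment a' b' \<inter> open_segment c' d' \<noteq> {}"
    unfolding crosses_def by blast
  then have "open_segment a' b' = open_segment a b" "open_segment c' d' = open_segment c d"
    by (auto simp: doubleton_eq_iff open_segment_commute)
  with ne show "open_segment a b \<inter> open_segment c d \<noteq> {}" by simp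
qed (unfold crosses_def, blast)

lemma crosses_sym: "crosses e f \<longleftrightarrow> crosses f e"
  unfolding crosses_def by (metis inf_commute)

lemma perfect_matching_edgeE:
  assumes "perfect_matching P M" "e \<in> M"
  obtains a b where "a \<in> P" "b \<in> P" "a \<noteq> b" "e = {a, b}"
proof -
  have "\<forall>e\<in>M. \<exists>a\<in>P. \<exists>b\<in>P. a \<noteq> b \<and> e = {a, b}"
    using assms(1) unfolding perfect_matching_def by (rule conjunct1)
  from bspec[OF this assms(2)] show thesis by (elim bexE conjE) (rule that)
qed

lemma perfect_matching_edge:
  assumes "perfect_matching P M" "{a, b} \<in> M"
  shows "a \<in> P" "b \<in> P" "a \<noteq> b"
proof -
  obtain x y where "x \<in> P" "y \<in> P" "x \<noteq> y" "{a, b} = {x, y}"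
    using perfect_matching_edgeE[OF assms] .
  then show "a \<in> P" "b \<in> P" "a \<noteq> b" by (auto simp: doubleton_eq_iff)
qed

lemma perfect_matching_unique:
  assumes "perfect_matching P M" "e \<in> M" "f \<in> M" "p \<in> e" "p \<in> f"
  shows "e = f"
proof -
  obtain a b where "a \<in> P" "b \<in> P" "e = {a, b}"
    using perfect_matching_edgeE[OF assms(1,2)] by metis
  then have "p \<in> P" using assms(4) by blast
  then show ?thesis using assms unfolding perfect_matching_def by metis
qed

lemma perfect_matching_Union:
  assumes "perfect_matching P M"
  shows "\<Union>M = P"
proof
  show "\<Union>M \<subseteq> P"
  proof clarify
    fix p e assume "p \<in> e" "e \<in> M"
    with assms obtain a b where "a \<in> P" "b \<in> P" "e = {a, b}"
      using perfect_matching_edgeE by metis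
    with \<open>p \<in> e\<close> show "p \<in> P" by blast
  qed
  show "P \<subseteq> \<Union>M"
    using assms unfolding perfect_matching_def by (metis UnionI subsetI)
qed

lemma perfect_matching_finite:
  assumes "perfect_matching P M" "finite P"
  shows "finite M"
proof (rule finite_subset)
  show "M \<subseteq> Pow P" using perfect_matching_Union[OF assms(1)] by blast
qed (use assms in simp)

lemma perfect_matching_disjoint:
  assumes "perfect_matching P M" "{a, b} \<in> M" "{c, d} \<in> M" "{a, b} \<noteq> {c, d}"
  shows "a \<noteq> c" "a \<noteq> d" "b \<noteq> c" "b \<noteq> d"
  using perfect_matching_unique[OF assms(1-3)] assms(4) by auto

lemma perfect_matching_exchange:
  assumes pm: "perfect_matching P M"
    and M: "{a, b} \<in> M" "{c, d} \<in> M" "{a, b} \<noteq> {c, d}"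
  shows "perfect_matching P ((M - {{a, b}, {c, d}}) \<union> {{a, c}, {b, d}})"
    (is "perfect_matching P ?M'")
proof -
  note P = perfect_matching_edge[OF pm M(1)] perfect_matching_edge[OF pm M(2)]
  note ne = perfect_matching_disjoint[OF pm M]
  have edges: "\<forall>e\<in>?M'. \<exists>x\<in>P. \<exists>y\<in>P. x \<noteq> y \<and> e = {x, y}"
    using pm P ne unfolding perfect_matching_def by blast
  \<comment> \<open>By uniqueness a remaining edge shares no endpoint with the two removed ones. So
    each of the four points sees only the new pair, and every other point sees exactly its old
    edges.\<close>
  have old: "p \<notin> {a, b, c, d}" if "e \<in> M - {{a, b}, {c, d}}" "p \<in> e" for e p
    using that perfect_matching_unique[OF pm _ M(1)] perfect_matching_unique[OF pm _ M(2)]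
    by blast
  have "\<exists>!e. e \<in> ?M' \<and> p \<in> e" if p: "p \<in> P" for p
  proof (cases "p \<in> {a, b, c, d}")
    case True
    then have *: "e \<in> ?M' \<and> p \<in> e \<longleftrightarrow> e \<in> {{a, c}, {b, d}} \<and> p \<in> e" for e
      using old by blast
    show ?thesis unfolding * using True P ne by auto
  next
    case False
    then have *: "e \<in> ?M' \<and> p \<in> e \<longleftrightarrow> e \<in> M \<and> p \<in> e" for e
      by auto
    show ?thesis unfolding * using pm p unfolding perfect_matching_def by blast
  qed
  with edges show ?thesis unfolding perfect_matching_def by simp
qed

lemma perfect_matching_successor:
  assumes pm: "perfect_matching P M" and "successor M M'"
  shows "perfect_matching P M'"
proof -
  obtain a b c d N where M: "{a, b} \<in> M" "{c, d} \<in> M" "{a, b} \<noteq> {c, d}"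
    and N: "N = {{a, c}, {b, d}} \<or> N = {{a, d}, {b, c}}"
    and M': "M' = (M - {{a, b}, {c, d}}) \<union> N"
    using assms(2) unfolding successor_def by (elim exE conjE) (rule that)
  from N show ?thesis
  proof
    assume "N = {{a, c}, {b, d}}"
    then show ?thesis using perfect_matching_exchange[OF pm M] M' by simp
  next
    assume "N = {{a, d}, {b, c}}"
    then show ?thesis
      using perfect_matching_exchange[OF pm, of a b d c] M M' by (simp add: insert_commute)
  qed
qed

lemma perfect_matching_valid_sequence:
  assumes "perfect_matching P M" "valid_sequence M k s" "i \<le> k"
  shows "perfect_matching P (s i)"
  using assms(3)
proof (induction i)
  case 0
  then show ?case using assms unfolding valid_sequence_def by simp
next
  case (Suc i)
  then show ?case
    using assms(2) perfect_matching_successor unfolding valid_sequence_def by fastforce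
qed

section \<open>Flips in lexicographic order\<close>

text \<open>General position allows two points with the same abscissa, so ties are broken by the
  ordinate to obtain a linear order.\<close>

definition lex_less :: "point \<Rightarrow> point \<Rightarrow> bool" where
  "lex_less p q \<longleftrightarrow> p $ 1 < q $ 1 \<or> (p $ 1 = q $ 1 \<and> p $ 2 < q $ 2)"

lemma lex_less_irrefl [simp]: "\<not> lex_less p p"
  by (simp add: lex_less_def)

lemma lex_less_trans: "lex_less p q \<Longrightarrow> lex_less q r \<Longrightarrow> lex_less p r"
  by (auto simp: lex_less_def)

lemma lex_less_linear: "p \<noteq> q \<Longrightarrow> lex_less p q \<or> lex_less q p"
  by (auto simp: lex_less_def vec_eq_iff forall_2)

text \<open>The points lexicographically before \<open>c\<close> form a convex set. If both
  endpoints share the abscissa of \<open>c\<close>, the ordinates decide; otherwise an endpoint with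
  strictly smaller abscissa makes the abscissa of \<open>z\<close> strictly smaller.\<close>

lemma open_segment_lex_less_right:
  assumes "z \<in> open_segment a b" "lex_less a c" "lex_less b c"
  shows "lex_less z c"
proof -
  obtain u where u: "0 < u" "u < 1" and z: "z = (1 - u) *\<^sub>R a + u *\<^sub>R b"
    using assms(1) by (auto simp: in_segment)
  have less: "(1 - u) * x + u * y < w" if "x \<le> w" "y \<le> w" "x < w \<or> y < w" for x y w :: real
  proof -
    have "(1 - u) * (w - x) + u * (w - y) > 0"
      using that u by (auto intro: add_pos_nonneg add_nonneg_pos)
    then show ?thesis by (simp add: algebra_simps)
  qed
  have coord: "z $ i = (1 - u) * a $ i + u * b $ i" for i
    by (simp add: z)
  show ?thesis
  proof (cases "a $ 1 = c $ 1 \<and> b $ 1 = c $ 1")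
    case True
    then have "z $ 1 = c $ 1" by (simp add: coord algebra_simps)
    moreover have "z $ 2 < c $ 2"
      using True assms by (auto simp: lex_less_def coord intro!: less)
    ultimately show ?thesis by (simp add: lex_less_def)
  next
    case False
    then have "z $ 1 < c $ 1"
      using assms by (auto simp: lex_less_def coord intro!: less)
    then show ?thesis by (simp add: lex_less_def)
  qed
qed

lemma open_segment_lex_less_left:
  assumes "z \<in> open_segment a b" "lex_less c a" "lex_less c b"
  shows "lex_less c z"
proof -
  \<comment> \<open>The point reflection \<open>p \<mapsto> - p\<close> reverses the order and maps
    open segments to open segments.\<close>
  have neg: "lex_less (- p) (- q) \<longleftrightarrow> lex_less q p" for p q
    by (auto simp: lex_less_def)
  have "- z \<in> open_segment (- a) (- b)"
    using assms(1) by (auto simp: in_segment)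
  then show ?thesis
    using open_segment_lex_less_right[of "- z" "- a" "- b" "- c"] assms by (simp add: neg)
qed

lemma open_segment_lex_less_endpoint:
  assumes "z \<in> open_segment a b" "lex_less a b"
  shows "lex_less z b"
proof -
  obtain u where u: "0 < u" "u < 1" and z: "z = (1 - u) *\<^sub>R a + u *\<^sub>R b"
    using assms(1) by (auto simp: in_segment)
  \<comment> \<open>\<open>b - z\<close> is a positive multiple of \<open>b - a\<close>, so
    \<open>z\<close> compares with \<open>b\<close> coordinatewise as \<open>a\<close> does.\<close>
  have "b $ i - z $ i = (1 - u) * (b $ i - a $ i)" for i
    by (simp add: z algebra_simps)
  then have "z $ i < b $ i \<longleftrightarrow> a $ i < b $ i" "z $ i = b $ i \<longleftrightarrow> a $ i = b $ i" for i
    using u by (smt (verit) mult_pos_pos mult_pos_neg mult_eq_0_iff)+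
  then show ?thesis using assms(2) by (simp add: lex_less_def)
qed

text \<open>The point \<open>c\<close> separates the two open segments: the first lies before it,
  the second after it.\<close>

lemma not_crosses_lex_separated:
  assumes "lex_less a c" "lex_less c b" "lex_less c d"
  shows "\<not> crosses {a, c} {b, d}"
proof -
  have False if "z \<in> open_segment a c" "z \<in> open_segment b d" for z
    using that open_segment_lex_less_endpoint[of z a c] open_segment_lex_less_left[of z b d c]
      assms lex_less_trans lex_less_irrefl by blast
  then show ?thesis unfolding crosses_pair_iff by blast
qed

section \<open>Total rank length of a matching\<close>

definition lex_rank :: "point set \<Rightarrow> point \<Rightarrow> nat" where
  "lex_rank P p = card {q \<in> P. lex_less q p}"

lemma lex_rank_less:
  assumes "finite P" "p \<in> P" "lex_less p q"
  shows "lex_rank P p < lex_rank P q"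
  unfolding lex_rank_def
proof (rule psubset_card_mono)
  have "{r \<in> P. lex_less r p} \<subseteq> {r \<in> P. lex_less r q}"
    using assms(3) lex_less_trans by auto
  moreover have "p \<in> {r \<in> P. lex_less r q}" "p \<notin> {r \<in> P. lex_less r p}"
    using assms by auto
  ultimately show "{r \<in> P. lex_less r p} \<subset> {r \<in> P. lex_less r q}" by blast
qed (use assms in simp)

lemma lex_rank_bij_betw:
  assumes "finite P"
  shows "bij_betw (lex_rank P) P {..<card P}"
proof -
  have inj: "inj_on (lex_rank P) P"
    by (rule inj_onI) (metis assms lex_rank_less lex_less_linear less_irrefl)
  have "lex_rank P ` P \<subseteq> {..<card P}"
  proof
    fix k assume "k \<in> lex_rank P ` P"
    then obtain p where "p \<in> P" "k = card {q \<in> P. lex_less q p}"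
      unfolding lex_rank_def by auto
    moreover have "p \<notin> {q \<in> P. lex_less q p}" by simp
    ultimately show "k \<in> {..<card P}"
      using psubset_card_mono[OF assms, of "{q \<in> P. lex_less q p}"] by blast
  qed
  \<comment> \<open>An injection into a finite set of the same cardinality is onto.\<close>
  then have "lex_rank P ` P = {..<card P}"
    by (simp add: card_subset_eq card_image[OF inj])
  with inj show ?thesis by (simp add: bij_betw_def)
qed

text \<open>\<open>Max\<close> and \<open>Min\<close> avoid choosing an order of the two endpoints
  of an edge, which is an unordered set.\<close>

definition edge_length :: "point set \<Rightarrow> edge \<Rightarrow> int" where
  "edge_length P e = Max ((\<lambda>p. int (lex_rank P p)) ` e) - Min ((\<lambda>p. int (lex_rank P p)) ` e)"

lemma edge_length_pair:
  "edge_length P {a, b} = \<bar>int (lex_rank P a) - int (lex_rank P b)\<bar>"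
  by (simp add: edge_length_def max_def min_def)

definition matching_length :: "point set \<Rightarrow> edge set \<Rightarrow> int" where
  "matching_length P M = (\<Sum>e\<in>M. edge_length P e)"

text \<open>The ranks are \<open>0, ..., 2 * n - 1\<close>, with middle \<open>n - 1/2\<close>; all
  distances are doubled to stay in the integers. Each odd number below \<open>2 * n\<close> occurs
  twice.\<close>

lemma sum_distance_to_middle:
  "(\<Sum>i<2 * n. \<bar>2 * int i - (2 * int n - 1)\<bar>) = 2 * (int n)\<^sup>2"
proof (induction n)
  case (Suc n)
  have "(\<Sum>i<2 * Suc n. \<bar>2 * int i - (2 * int (Suc n) - 1)\<bar>) =
      (\<Sum>i<Suc (Suc (2 * n)). \<bar>2 * int i - (2 * int n + 1)\<bar>)"
    by (simp add: add.commute del: sum.lessThan_Suc)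
  \<comment> \<open>The first index is split off and the others are shifted down by one. The last
    index is split off next; both contribute \<open>2 * n + 1\<close>.\<close>
  also have "\<dots> = (2 * int n + 1) + (\<Sum>i<Suc (2 * n). \<bar>2 * int i - (2 * int n - 1)\<bar>)"
    by (subst sum.lessThan_Suc_shift) (simp del: sum.lessThan_Suc add: algebra_simps)
  also have "\<dots> = 2 * (int (Suc n))\<^sup>2"
    using Suc.IH by (simp add: power2_eq_square algebra_simps)
  finally show ?case .
qed simp

text \<open>Here \<open>w p\<close> is twice the distance of the rank of \<open>p\<close> to the
  middle, and the bound for one edge is the triangle inequality. The edges partition
  \<open>P\<close>, so the double sum runs over every rank once.\<close>

lemma matching_length_le:
  assumes P: "finite P" "card P = 2 * n" and pm: "perfect_matching P M"
  shows "matching_length P M \<le> (int n)\<^sup>2"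
proof -
  define w where "w p = \<bar>2 * int (lex_rank P p) - (2 * int n - 1)\<bar>" for p
  have edge: "2 * edge_length P e \<le> (\<Sum>p\<in>e. w p)" if "e \<in> M" for e
  proof -
    obtain a b where ab: "a \<noteq> b" "e = {a, b}"
      using perfect_matching_edgeE[OF pm \<open>e \<in> M\<close>] by metis
    then have "(\<Sum>p\<in>e. w p) = w a + w b" by simp
    moreover have "2 * edge_length P e \<le> w a + w b"
      unfolding ab(2) edge_length_pair w_def by arith
    ultimately show ?thesis by simp
  qed
  have "2 * matching_length P M \<le> (\<Sum>e\<in>M. \<Sum>p\<in>e. w p)"
    unfolding matching_length_def sum_distrib_left by (rule sum_mono) (rule edge)
  also have "\<dots> = (sum \<circ> sum) w M" by simp
  also have "\<dots> = (\<Sum>p\<in>\<Union>M. w p)"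
  proof (rule sum.Union_disjoint[symmetric])
    show "\<forall>e\<in>M. finite e"
      using perfect_matching_edgeE[OF pm] by (metis finite.emptyI finite.insertI)
    show "\<forall>e\<in>M. \<forall>f\<in>M. e \<noteq> f \<longrightarrow> e \<inter> f = {}"
      using perfect_matching_unique[OF pm] by blast
  qed
  also have "\<dots> = (\<Sum>i<2 * n. \<bar>2 * int i - (2 * int n - 1)\<bar>)"
    unfolding perfect_matching_Union[OF pm] w_def
    using sum.reindex_bij_betw[OF lex_rank_bij_betw[OF P(1)],
        of "\<lambda>i. \<bar>2 * int i - (2 * int n - 1)\<bar>"] P(2) by simp
  finally show ?thesis by (simp add: sum_distance_to_middle)
qed

text \<open>Let \<open>a\<close> be the first of the four points. Crossing forces \<open>c\<close>
  before \<open>b\<close>, so \<open>a\<close> and \<open>c\<close> are the two smallest. The flip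
  to \<open>{a, c}\<close>, \<open>{b, d}\<close> then shortens the total by twice the rank gap
  between \<open>c\<close> and the earlier of \<open>b\<close> and \<open>d\<close>, hence by at
  least 2.\<close>

lemma lex_flip:
  assumes P: "finite P" and pm: "perfect_matching P M"
    and M: "{a, b} \<in> M" "{c, d} \<in> M" and cr: "crosses {a, b} {c, d}"
    and less: "lex_less a b" "lex_less c d" "lex_less a c"
  shows "\<exists>M'. successor M M' \<and> matching_length P M' + 2 \<le> matching_length P M"
proof -
  have ne: "{a, b} \<noteq> {c, d}"
    unfolding doubleton_eq_iff using less lex_less_trans lex_less_irrefl by metis
  note dis = perfect_matching_disjoint[OF pm M ne]
  \<comment> \<open>Otherwise \<open>b\<close> would separate \<open>{a, b}\<close> from
    \<open>{c, d}\<close>.\<close>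
  have cb: "lex_less c b"
    using lex_less_linear[OF dis(3)] not_crosses_lex_separated[of a b c d] cr less lex_less_trans
    by metis
  define M' where "M' = (M - {{a, b}, {c, d}}) \<union> {{a, c}, {b, d}}"
  have nc: "\<not> crosses {a, c} {b, d}"
    using not_crosses_lex_separated[OF less(3) cb less(2)] .
  then have "noncrossing {{a, c}, {b, d}}"
    unfolding noncrossing_def using crosses_sym by blast
  then have succ: "successor M M'"
    unfolding successor_def M'_def using M ne cr by blast
  have fin: "finite M" using perfect_matching_finite[OF pm P] .
  have P': "a \<in> P" "b \<in> P" "c \<in> P" "d \<in> P"
    using perfect_matching_edge[OF pm] M by blast+
  have "matching_length P M = matching_length P (M - {{a, b}, {c, d}})
      + (edge_length P {a, b} + edge_length P {c, d})"
    unfolding matching_length_def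
    using sum.subset_diff[of "{{a, b}, {c, d}}" M "edge_length P"] fin M ne by simp
  moreover have "matching_length P M' \<le> matching_length P (M - {{a, b}, {c, d}})
      + (edge_length P {a, c} + edge_length P {b, d})"
  proof -
    \<comment> \<open>Each new edge meets \<open>{a, b}\<close>, so it cannot be one of the
      remaining edges; the sum for \<open>M'\<close> therefore splits.\<close>
    have "{a, c} \<notin> M - {{a, b}, {c, d}}" "{b, d} \<notin> M - {{a, b}, {c, d}}"
      using perfect_matching_unique[OF pm _ M(1)] by blast+
    moreover have "{a, c} \<noteq> {b, d}" using dis less by (auto simp: doubleton_eq_iff)
    ultimately show ?thesis unfolding matching_length_def M'_def using fin by simp
  qed
  moreover have "lex_rank P a < lex_rank P c" "lex_rank P c < lex_rank P b"
    "lex_rank P c < lex_rank P d"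
    using lex_rank_less[OF P] P' less cb by blast+
  ultimately have "matching_length P M' + 2 \<le> matching_length P M"
    by (simp add: edge_length_pair)
  with succ show ?thesis by blast
qed

lemma exists_shortening_flip:
  assumes P: "finite P" and pm: "perfect_matching P M" and "\<not> noncrossing M"
  shows "\<exists>M'. successor M M' \<and> matching_length P M' + 2 \<le> matching_length P M"
proof -
  obtain e f where ef: "e \<in> M" "f \<in> M" "e \<noteq> f" "crosses e f"
    using assms(3) unfolding noncrossing_def by blast
  have ordered: "\<exists>a b. lex_less a b \<and> e = {a, b}" if "e \<in> M" for e
    using perfect_matching_edgeE[OF pm that] lex_less_linear by (metis insert_commute)
  obtain a b where ab: "lex_less a b" "e = {a, b}" using ordered[OF ef(1)] by blast
  obtain c d where cd: "lex_less c d" "f = {c, d}" using ordered[OF ef(2)] by blast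
  have "a \<noteq> c" using perfect_matching_disjoint[OF pm] ef ab cd by blast
  \<comment> \<open>Crossing is symmetric, so the edge with the earlier left endpoint may play the
    role of \<open>{a, b}\<close>.\<close>
  then consider "lex_less a c" | "lex_less c a" using lex_less_linear by blast
  then show ?thesis
    using lex_flip[OF P pm] ef ab cd crosses_sym by cases blast+
qed

text \<open>The length is a nonnegative potential, and each shortening flip pays 2 units of it.
  Induction on the potential gives both termination and the bound on the number of flips.\<close>

lemma exists_short_valid_sequence:
  assumes P: "finite P" and "perfect_matching P M"
  shows "\<exists>k s. valid_sequence M k s \<and> 2 * int k \<le> matching_length P M"
  using assms(2)
proof (induction "nat (matching_length P M)" arbitrary: M rule: less_induct)
  case less
  have pm: "perfect_matching P M" by fact
  have nonneg: "0 \<le> matching_length P K" if "perfect_matching P K" for K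
    unfolding matching_length_def
  proof (rule sum_nonneg)
    fix e assume "e \<in> K"
    then obtain a b where "e = {a, b}"
      using perfect_matching_edgeE[OF \<open>perfect_matching P K\<close>] by metis
    then show "0 \<le> edge_length P e" by (simp add: edge_length_pair)
  qed
  show ?case
  proof (cases "noncrossing M")
    case True
    then have "valid_sequence M 0 (\<lambda>_. M)" by (simp add: valid_sequence_def)
    then show ?thesis using nonneg[OF pm] by fastforce
  next
    case False
    then obtain M' where M': "successor M M'" "matching_length P M' + 2 \<le> matching_length P M"
      using exists_shortening_flip[OF P pm] by blast
    have pm': "perfect_matching P M'" using perfect_matching_successor[OF pm M'(1)] .
    obtain k s where s: "valid_sequence M' k s" "2 * int k \<le> matching_length P M'"
      using less.hyps[OF _ pm'] M' nonneg[OF pm'] by force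
    \<comment> \<open>\<open>case_nat M s\<close> is the sequence \<open>s\<close> with
      \<open>M\<close> put in front.\<close>
    have "valid_sequence M (Suc k) (case_nat M s)"
      using s(1) M'(1) unfolding valid_sequence_def
      by (auto simp: less_Suc_eq_0_disj)
    then show ?thesis using s(2) M'(2) by (intro exI conjI) auto
  qed
qed

lemma max_min_flips_le: "max_min_flips n \<le> enat (n\<^sup>2 div 2)"
  unfolding max_min_flips_def
proof (rule Sup_least, clarify)
  fix M P assume P: "finite P" "card P = 2 * n" and pm: "perfect_matching P M"
  obtain k s where s: "valid_sequence M k s" "2 * int k \<le> matching_length P M"
    using exists_short_valid_sequence[OF P(1) pm] by blast
  have "int (2 * k) \<le> int (n\<^sup>2)" using s(2) matching_length_le[OF P pm] by simp
  then have "k \<le> n\<^sup>2 div 2" unfolding of_nat_le_iff by linarith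
  moreover have "min_flips M \<le> enat k"
    unfolding min_flips_def using s(1) by (intro Inf_lower) blast
  ultimately show "min_flips M \<le> enat (n\<^sup>2 div 2)"
    by (meson enat_ord_simps(1) order_trans)
qed

section \<open>Horizontal chords of a parabola\<close>

definition para :: "int \<Rightarrow> point" where
  "para k = vector [of_int k, (of_int k)\<^sup>2]"

lemma para_nth [simp]: "para k $ 1 = of_int k" "para k $ 2 = (of_int k)\<^sup>2"
  by (simp_all add: para_def)

lemma para_eq_iff [simp]: "para j = para k \<longleftrightarrow> j = k"
  by (metis para_nth(1) of_int_eq_iff)

lemma not_collinear_para:
  assumes "a \<noteq> b" "b \<noteq> c" "a \<noteq> c"
  shows "\<not> collinear {para a, para b, para c}"
proof
  assume "collinear {para a, para b, para c}"
  then obtain u s t where "para b - para a = s *\<^sub>R u" "para c - para a = t *\<^sub>R u"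
    unfolding collinear_def by blast
  then have "(para b - para a) $ i = s * u $ i" "(para c - para a) $ i = t * u $ i" for i
    by simp_all
  from this[of 1] this[of 2]
  have *: "real_of_int b - a = s * u $ 1" "(real_of_int b)\<^sup>2 - (real_of_int a)\<^sup>2 = s * u $ 2"
    "real_of_int c - a = t * u $ 1" "(real_of_int c)\<^sup>2 - (real_of_int a)\<^sup>2 = t * u $ 2"
    by simp_all
  \<comment> \<open>The two difference vectors are multiples of \<open>u\<close>, so their
    determinant vanishes; it factors as a Vandermonde product.\<close>
  have "(real_of_int b - a) * ((real_of_int c)\<^sup>2 - (real_of_int a)\<^sup>2)
      = (real_of_int c - a) * ((real_of_int b)\<^sup>2 - (real_of_int a)\<^sup>2)"
    unfolding * by simp
  then have "(real_of_int b - a) * (real_of_int c - a) * (real_of_int c - b) = 0"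
    by (simp add: power2_eq_square algebra_simps)
  then show False using assms by simp
qed

definition hchord :: "int \<Rightarrow> edge" where
  "hchord i = {para (- i), para i}"

text \<open>The chords lie at the different heights \<open>i\<^sup>2\<close> and
  \<open>j\<^sup>2\<close>.\<close>

lemma hchord_not_crosses:
  assumes "0 < i" "0 < j" "i \<noteq> j"
  shows "\<not> crosses (hchord i) (hchord j)"
proof -
  have height: "z $ 2 = (real_of_int i)\<^sup>2" if z: "z \<in> open_segment (para (- i)) (para i)" for z i
  proof -
    obtain u where "z = (1 - u) *\<^sub>R para (- i) + u *\<^sub>R para i"
      using z unfolding in_segment by blast
    then have "z $ 2 = (1 - u) * (real_of_int i)\<^sup>2 + u * (real_of_int i)\<^sup>2" by simp
    then show ?thesis by (simp add: algebra_simps)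
  qed
  have "(real_of_int i)\<^sup>2 \<noteq> (real_of_int j)\<^sup>2"
    using assms by simp
  then show ?thesis unfolding hchord_def crosses_pair_iff using height
    by (metis disjoint_iff)
qed

text \<open>One endpoint lies on the parabola below the chord and the other above it. The proof
  computes the intersection point \<open>z\<close> and its parameters on both segments.\<close>

lemma hchord_crosses:
  assumes "\<bar>a\<bar> < i" "i < \<bar>b\<bar>"
  shows "crosses {para a, para b} (hchord i)"
proof -
  define A B I where "A = real_of_int a" and "B = real_of_int b" and "I = real_of_int i"
  have AI: "\<bar>A\<bar> < I" "I < \<bar>B\<bar>" using assms unfolding A_def B_def I_def by linarith+
  have AB: "A + B \<noteq> 0" using AI by auto
  \<comment> \<open>The line through the two points is \<open>y = (A + B) * x - A * B\<close>;
    \<open>x\<close> is its abscissa at height \<open>I\<^sup>2\<close>. The parameter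
    \<open>u\<close> comes from comparing heights, and \<open>v\<close> is the position of
    \<open>x\<close> between \<open>- I\<close> and \<open>I\<close>.\<close>
  define x where "x = (A * B + I\<^sup>2) / (A + B)"
  define u where "u = (I\<^sup>2 - A\<^sup>2) / (B\<^sup>2 - A\<^sup>2)"
  define v where "v = (x + I) / (2 * I)"
  define z :: point where "z = vector [x, I\<^sup>2]"
  have sq: "A\<^sup>2 < I\<^sup>2" "I\<^sup>2 < B\<^sup>2"
    using AI abs_le_square_iff[of I A] abs_le_square_iff[of B I] by auto
  have u: "0 < u" "u < 1" using sq by (simp_all add: u_def)
  have xI: "I - x = (I - A) * (B - I) / (A + B)" "x + I = (A + I) * (B + I) / (A + B)"
    using AB by (simp_all add: x_def field_simps power2_eq_square)
  \<comment> \<open>\<open>A + B\<close> has the sign of \<open>B\<close>, as have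
    \<open>B - I\<close> and \<open>B + I\<close>, while \<open>I - A\<close> and
    \<open>A + I\<close> are positive.\<close>
  have "0 < I - x \<and> 0 < x + I"
  proof (cases "0 < B")
    case True
    then show ?thesis unfolding xI using AI by simp
  next
    case False
    then show ?thesis unfolding xI using AI
      by (auto intro!: divide_neg_neg mult_pos_neg)
  qed
  then have v: "0 < v" "v < 1" using AI by (simp_all add: v_def)
  have "(1 - u) * A + u * B = x"
  proof -
    have "u = (I\<^sup>2 - A\<^sup>2) / ((A + B) * (B - A))"
      by (simp add: u_def power2_eq_square algebra_simps)
    then have "u * (B - A) = (I\<^sup>2 - A\<^sup>2) / (A + B)" using sq by auto
    then have "A + u * (B - A) = x" using AB
      by (simp add: x_def field_simps power2_eq_square)
    then show ?thesis by (simp add: algebra_simps)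
  qed
  moreover have "(1 - u) * A\<^sup>2 + u * B\<^sup>2 = I\<^sup>2"
  proof -
    have "u * (B\<^sup>2 - A\<^sup>2) = I\<^sup>2 - A\<^sup>2" using sq by (simp add: u_def)
    then show ?thesis by (simp add: algebra_simps)
  qed
  ultimately have "z = (1 - u) *\<^sub>R para a + u *\<^sub>R para b"
    by (simp add: vec_eq_iff forall_2 z_def A_def B_def)
  then have "z \<in> open_segment (para a) (para b)"
    using u assms by (auto simp: in_segment)
  moreover have "(1 - v) * (- I) + v * I = x"
    using AI by (simp add: v_def field_simps)
  then have "z = (1 - v) *\<^sub>R para (- i) + v *\<^sub>R para i"
    by (simp add: vec_eq_iff forall_2 z_def I_def algebra_simps)
  then have "z \<in> open_segment (para (- i)) (para i)"
    using v assms by (auto simp: in_segment)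
  ultimately show ?thesis unfolding hchord_def crosses_pair_iff by blast
qed

section \<open>The extremal matching on the parabola\<close>

definition para_points :: "nat \<Rightarrow> point set" where
  "para_points n = para ` {- (int n - 1)..int n}"

definition hchords :: "nat \<Rightarrow> edge set" where
  "hchords n = hchord ` {1..int n - 1}"

text \<open>The extra edge joins the two points without a partner under reflection in the axis:
  abscissa 0 is its own mirror image, and \<open>- n\<close> is absent.\<close>

definition para_matching :: "nat \<Rightarrow> edge set" where
  "para_matching n = insert {para 0, para (int n)} (hchords n)"

lemma card_para_points: "card (para_points n) = 2 * n"
  unfolding para_points_def by (subst card_image) (auto intro: inj_onI)

lemma card_hchords: "card (hchords n) = n - 1"
  unfolding hchords_def
  by (subst card_image) (auto intro!: inj_onI simp: hchord_def doubleton_eq_iff)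

lemma general_position_para_points: "general_position (para_points n)"
  unfolding general_position_def para_points_def using not_collinear_para by auto

lemma perfect_matching_para_matching:
  assumes "1 \<le> n"
  shows "perfect_matching (para_points n) (para_matching n)"
  unfolding perfect_matching_def
proof (intro conjI ballI)
  fix e assume "e \<in> para_matching n"
  then consider "e = {para 0, para (int n)}" | i where "1 \<le> i" "i \<le> int n - 1" "e = {para (- i), para i}"
    unfolding para_matching_def hchords_def hchord_def by auto
  then show "\<exists>a\<in>para_points n. \<exists>b\<in>para_points n. a \<noteq> b \<and> e = {a, b}"
  proof cases
    case 1
    then show ?thesis using assms unfolding para_points_def
      by (intro bexI[of _ "para 0"] bexI[of _ "para (int n)"]) auto
  next
    case (2 i)
    then show ?thesis unfolding para_points_def
      by (intro bexI[of _ "para (- i)"] bexI[of _ "para i"]) auto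
  qed
next
  fix p assume "p \<in> para_points n"
  then obtain k where k: "p = para k" "- (int n - 1) \<le> k" "k \<le> int n"
    unfolding para_points_def by auto
  show "\<exists>!e. e \<in> para_matching n \<and> p \<in> e"
  proof (cases "k = 0 \<or> k = int n")
    case True
    then show ?thesis
      by (intro ex1I[of _ "{para 0, para (int n)}"])
        (auto simp: para_matching_def hchords_def hchord_def k(1))
  next
    case False
    have "hchord \<bar>k\<bar> \<in> hchords n"
      unfolding hchords_def using False k by (intro imageI) auto
    then show ?thesis using False
      by (intro ex1I[of _ "hchord \<bar>k\<bar>"])
        (auto simp: para_matching_def hchords_def hchord_def k(1) abs_if)
  qed
qed

text \<open>Such a set is a disjoint union of edges, each with two points.\<close>

lemma even_card_closed_under_matching:
  assumes pm: "perfect_matching P M" and "S \<subseteq> P"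
    and closed: "\<And>e. e \<in> M \<Longrightarrow> e \<inter> S \<noteq> {} \<Longrightarrow> e \<subseteq> S"
  shows "even (card S)"
proof -
  define K where "K = {e \<in> M. e \<inter> S \<noteq> {}}"
  have two: "card e = 2" if "e \<in> M" for e
    using perfect_matching_edgeE[OF pm that] by (metis card_2_iff)
  have "S = \<Union>K"
    using closed perfect_matching_Union[OF pm] \<open>S \<subseteq> P\<close> unfolding K_def by blast
  also have "card \<dots> = (\<Sum>e\<in>K. card e)"
  proof (rule card_Union_disjoint)
    show "pairwise disjnt K"
      unfolding pairwise_def disjnt_def K_def using perfect_matching_unique[OF pm] by blast
    \<comment> \<open>An infinite set has \<open>card\<close> 0, so \<open>card e = 2\<close> gives
      finiteness.\<close>
    show "finite e" if "e \<in> K" for e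
      using that two unfolding K_def by (metis (lifting) card.infinite mem_Collect_eq zero_neq_numeral)
  qed
  also have "\<dots> = 2 * card K" using two by (simp add: K_def)
  finally show ?thesis by simp
qed

text \<open>The set \<open>S\<close> of points strictly below the chord has odd size
  \<open>2 * i - 1\<close>. If the chord were present, an edge leaving \<open>S\<close> could not
  end at \<open>para i\<close> or \<open>para (- i)\<close>, so it would end above the chord and
  cross it. Hence \<open>S\<close> would be closed under the matching, against parity.\<close>

lemma hchord_notin_noncrossing:
  assumes pm: "perfect_matching (para_points n) M" and nc: "noncrossing M"
    and i: "1 \<le> i" "i \<le> int n - 1"
  shows "hchord i \<notin> M"
proof
  assume M: "hchord i \<in> M"
  define S where "S = para ` {- (i - 1)..i - 1}"
  have "even (card S)"
  proof (rule even_card_closed_under_matching[OF pm])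
    show "S \<subseteq> para_points n" using i unfolding S_def para_points_def by (intro image_mono) auto
    fix e assume e: "e \<in> M" "e \<inter> S \<noteq> {}"
    obtain x y where xy: "e = {x, y}" "x \<in> para_points n" "y \<in> para_points n"
      using perfect_matching_edgeE[OF pm e(1)] by metis
    then obtain p q where pq: "e = {p, q}" "p \<in> S" "q \<in> para_points n"
      using e(2) by (cases "x \<in> S") (auto simp: insert_commute)
    obtain a b where ab: "p = para a" "\<bar>a\<bar> < i" "q = para b"
      using pq(2,3) unfolding S_def para_points_def by fastforce
    have ne: "e \<noteq> hchord i"
      using ab pq i unfolding hchord_def by (auto simp: doubleton_eq_iff)
    then have "b \<noteq> i" "b \<noteq> - i"
      using perfect_matching_unique[OF pm e(1) M, of q] pq ab unfolding hchord_def by auto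
    moreover have "\<not> i < \<bar>b\<bar>"
    proof
      assume "i < \<bar>b\<bar>"
      then have "crosses e (hchord i)" using hchord_crosses[OF ab(2)] pq(1) ab by simp
      with nc e(1) M ne show False unfolding noncrossing_def by simp
    qed
    ultimately have "q \<in> S" unfolding S_def ab by (intro imageI) auto
    then show "e \<subseteq> S" using pq by simp
  qed
  moreover have "card S = nat (2 * i - 1)"
    unfolding S_def by (subst card_image) (auto intro: inj_onI)
  ultimately show False using i by (simp add: even_nat_iff)
qed

text \<open>The two edges removed by a flip cross, so at most one of them is a horizontal chord; the
  inserted edges cannot lower the count.\<close>

lemma successor_card_hchords:
  assumes "successor M M'"
  shows "card (hchords n \<inter> M) \<le> Suc (card (hchords n \<inter> M'))"
proof -
  obtain e f where ef: "crosses e f" "e \<noteq> f" and M': "M - {e, f} \<subseteq> M'"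
    using assms unfolding successor_def by (elim exE conjE) (rule that, auto)
  have "e \<notin> hchords n \<or> f \<notin> hchords n"
  proof (rule ccontr)
    assume "\<not> ?thesis"
    then obtain i j where "1 \<le> i" "1 \<le> j" "e = hchord i" "f = hchord j"
      unfolding hchords_def by auto
    with ef hchord_not_crosses[of i j] show False by auto
  qed
  then obtain g where "hchords n \<inter> M \<subseteq> insert g (hchords n \<inter> M')"
    using M' by blast
  moreover have fin: "finite (hchords n)" by (simp add: hchords_def)
  ultimately have "card (hchords n \<inter> M) \<le> card (insert g (hchords n \<inter> M'))"
    by (intro card_mono) auto
  also have "\<dots> \<le> Suc (card (hchords n \<inter> M'))" by (rule card_insert_le_m1) auto
  finally show ?thesis .
qed

lemma valid_sequence_para_matching:
  assumes "1 \<le> n" and s: "valid_sequence (para_matching n) k s"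
  shows "n - 1 \<le> k"
proof -
  \<comment> \<open>After \<open>i\<close> flips at least \<open>n - 1 - i\<close> chords survive,
    while a noncrossing final matching contains none.\<close>
  have "n - 1 \<le> card (hchords n \<inter> s i) + i" if "i \<le> k" for i
    using that
  proof (induction i)
    case 0
    have "hchords n \<inter> s 0 = hchords n"
      using s unfolding valid_sequence_def para_matching_def by auto
    then show ?case by (simp add: card_hchords)
  next
    case (Suc i)
    then show ?case
      using s successor_card_hchords[of "s i" "s (Suc i)" n] unfolding valid_sequence_def by simp
  qed
  moreover have "hchords n \<inter> s k = {}"
  proof -
    have "perfect_matching (para_points n) (s k)"
      using perfect_matching_valid_sequence[OF perfect_matching_para_matching s] assms(1) by simp
    then show ?thesis
      using hchord_notin_noncrossing s unfolding valid_sequence_def hchords_def by auto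
  qed
  ultimately show ?thesis by (metis card.empty add_0 order_refl)
qed

lemma max_min_flips_ge:
  assumes "1 \<le> n"
  shows "enat (n - 1) \<le> max_min_flips n"
proof -
  have "enat (n - 1) \<le> min_flips (para_matching n)"
    unfolding min_flips_def
    \<comment> \<open>A lower bound for every valid length bounds the infimum, whose value would be
      infinity if no valid sequence existed.\<close>
    by (rule Inf_greatest) (use valid_sequence_para_matching[OF assms] in auto)
  also have "\<dots> \<le> max_min_flips n"
    unfolding max_min_flips_def
    using card_para_points general_position_para_points perfect_matching_para_matching[OF assms]
    by (intro Sup_upper) (auto simp: para_points_def intro!: exI[of _ "para_points n"])
  finally show ?thesis .
qed

theorem theorem2:
  "\<exists>N::nat. \<forall>n\<ge>N.
     ereal (real n - 1) \<le> ereal_of_enat (max_min_flips n) \<and>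
     ereal_of_enat (max_min_flips n) \<le> ereal ((real n)\<^sup>2 / 2)"
proof (intro exI[of _ 1] allI impI conjI)
  fix n :: nat assume n: "1 \<le> n"
  \<comment> \<open>From the threshold \<open>1\<close> on, truncated subtraction in
    \<open>n - 1\<close> agrees with the real difference.\<close>
  have "ereal (real n - 1) = ereal_of_enat (enat (n - 1))"
    using n by simp
  also have "\<dots> \<le> ereal_of_enat (max_min_flips n)"
    using max_min_flips_ge[OF n] by (simp only: ereal_of_enat_le_iff)
  finally show "ereal (real n - 1) \<le> ereal_of_enat (max_min_flips n)" .
  have "ereal_of_enat (max_min_flips n) \<le> ereal_of_enat (enat (n\<^sup>2 div 2))"
    using max_min_flips_le by (simp only: ereal_of_enat_le_iff)
  also have "\<dots> \<le> ereal ((real n)\<^sup>2 / 2)"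
    using of_nat_div_le_of_nat[of "n\<^sup>2" 2, where 'a = real] by simp
  finally show "ereal_of_enat (max_min_flips n) \<le> ereal ((real n)\<^sup>2 / 2)" .
qed

end
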